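(* For $i=1,2$, let $\mathcal{G}_{i}=(G,(K_{v}^{i})_{v\in V},(\phi_{e}^{i})_{e\in E})$ be two Mauldin-Williams graphs over the same underlying graph $G=(V,E,r,s)$. Let $K^i=\coprod_{v\in V}K^i_v$, $A_{i}=C(K^{i})$, and let $\mathcal{X}_{i}$ be the associated $C^{*}$-correspondence over $A_i$. If $\mathcal{X}_{1}$ and $\mathcal{X}_{2}$ are isomorphic as $C^*$-correspondences, then there are a homeomorphism $f:K^{1}\rightarrow K^{2}$, a finite open cover $\{U_{1},\dots,U_{m}\}$ of $K^{1}$, and for each $j\in\{1,\dots,m\}$ a permutation $\sigma_{j}$ of $E$, such that $$f^{-1}\circ\phi_{e}^{2}\circ f|_{U_{j}}=\phi_{\sigma_{j}(e)}^{1}|_{U_{j}}\quad\text{for all } e\in E,\ j\in\{1,\dots,m\}.$$ Here the equality is one of partially defined maps on $U_j$: for $x\in U_j$, one has $f(x)\in K^2_{r(e)}$ if and only if $x\in K^1_{r(\sigma_j(e))}$, and in that case $f^{-1}(\phi^2_e(f(x)))=\phi^1_{\sigma_j(e)}(x)$.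
   Context: Mauldin-Williams graph: a system $\mathcal{G}=(G,(K_v)_{v\in V},(\phi_e)_{e\in E})$ where $G=(V,E,r,s)$ is a directed graph with finite vertex set $V$, finite edge set $E$, and surjective range and source maps $r,s:E\to V$ (no sinks, no sources); each $K_v$ is a nonempty compact metric space with metric $\rho_v$; and for each $e\in E$, $\phi_e:K_{r(e)}\to K_{s(e)}$ is a map with $c_1\rho_{r(e)}(x,y)\le\rho_{s(e)}(\phi_e(x),\phi_e(y))\le c\,\rho_{r(e)}(x,y)$ for all $x,y\in K_{r(e)}$, for constants $0<c_1\le c<1$ independent of $e$. Standing assumption: $(K_v)_{v\in V}$ is the invariant list of $\mathcal G$, i.e. $K_v=\bigcup_{e\in E,\,s(e)=v}\phi_e(K_{r(e)})$ for every $v\in V$. Write $K=\coprod_{v\in V}K_v$ (disjoint union). Associated correspondence: let $E\times_G K=\{(e,x): e\in E,\ x\in K_{r(e)}\}$ (a compact space) and $A=C(K)$. The $C^*$-correspondence $\mathcal X$ over $A$ associated with $\mathcal G$ is $\mathcal X=C(E\times_G K)$ with $(\xi\cdot a)(e,x)=\xi(e,x)a(x)$, $(a\cdot\xi)(e,x)=a(\phi_e(x))\xi(e,x)$ and $\langle\xi,\eta\rangle_A(x)=\sum_{e\in E,\,x\in K_{r(e)}}\overline{\xi(e,x)}\eta(e,x)$. Isomorphism of correspondences: $\mathcal X_1$ over $A_1$ and $\mathcal X_2$ over $A_2$ are isomorphic as $C^*$-correspondences if there are a $*$-isomorphism $\alpha:A_1\to A_2$ and a surjective linear map $V:\mathcal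 X_1\to\mathcal X_2$ with $V(a\xi b)=\alpha(a)V(\xi)\alpha(b)$ and $\langle V\xi,V\eta\rangle_{A_2}=\alpha(\langle\xi,\eta\rangle_{A_1})$. *)

theory Defs
  imports
    "HOL-Analysis.Analysis"
    "HOL-Combinatorics.Permutations"
    "Graph_Theory.Digraph"
begin

section \<open>Mauldin-Williams graphs\<close>

text \<open>
  The range map \<open>r\<close> is \<open>head G\<close> and the source map \<open>s\<close> is \<open>tail G\<close>. A map \<open>\<phi> e\<close> is only
  meaningful on \<open>mspace (K (head G e))\<close>; its values elsewhere are arbitrary.
\<close>

locale mauldin_williams_graph = fin_digraph G
  for G :: "('v, 'e) pre_digraph" (structure) +
  fixes K :: "'v \<Rightarrow> 'a metric"
    and \<phi> :: "'e \<Rightarrow> 'a \<Rightarrow> 'a"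
  assumes range_surj: "head G ` arcs G = verts G"
    and source_surj: "tail G ` arcs G = verts G"
    and nonempty_K: "v \<in> verts G \<Longrightarrow> mspace (K v) \<noteq> {}"
    and compact_K: "v \<in> verts G \<Longrightarrow> compact_space (mtopology_of (K v))"
    and maps_\<phi>: "e \<in> arcs G \<Longrightarrow> \<phi> e \<in> mspace (K (head G e)) \<rightarrow> mspace (K (tail G e))"
    and lipschitz_\<phi>:
      "\<exists>c\<^sub>1 c. 0 < c\<^sub>1 \<and> c\<^sub>1 \<le> c \<and> c < 1 \<and>
        (\<forall>e\<in>arcs G. \<forall>x\<in>mspace (K (head G e)). \<forall>y\<in>mspace (K (head G e)).
          c\<^sub>1 * mdist (K (head G e)) x y \<le> mdist (K (tail G e)) (\<phi> e x) (\<phi> e y) \<and>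
          mdist (K (tail G e)) (\<phi> e x) (\<phi> e y) \<le> c * mdist (K (head G e)) x y)"

definition invariant_list ::
  "('v, 'e) pre_digraph \<Rightarrow> ('v \<Rightarrow> 'a metric) \<Rightarrow> ('e \<Rightarrow> 'a \<Rightarrow> 'a) \<Rightarrow> bool" where
  "invariant_list G K \<phi> \<longleftrightarrow>
    (\<forall>v\<in>verts G. mspace (K v) = (\<Union>e\<in>{e \<in> arcs G. tail G e = v}. \<phi> e ` mspace (K (head G e))))"

text \<open>
  Points of the disjoint union \<open>K\<close> are pairs \<open>(v, y)\<close> with \<open>y \<in> K\<^sub>v\<close>; \<open>mw_piece K v\<close> is the copy of
  \<open>K\<^sub>v\<close> inside \<open>K\<close>, and \<open>mw_map G \<phi> e\<close> is \<open>\<phi>\<^sub>e\<close> as a map from the copy of \<open>K\<^bsub>r(e)\<^esub>\<close> to the copy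
  of \<open>K\<^bsub>s(e)\<^esub>\<close>.
\<close>

definition mw_space :: "('v, 'e) pre_digraph \<Rightarrow> ('v \<Rightarrow> 'a metric) \<Rightarrow> ('v \<times> 'a) topology" where
  "mw_space G K = sum_topology (\<lambda>v. mtopology_of (K v)) (verts G)"

definition mw_piece :: "('v \<Rightarrow> 'a metric) \<Rightarrow> 'v \<Rightarrow> ('v \<times> 'a) set" where
  "mw_piece K v = {v} \<times> mspace (K v)"

definition mw_map :: "('v, 'e) pre_digraph \<Rightarrow> ('e \<Rightarrow> 'a \<Rightarrow> 'a) \<Rightarrow> 'e \<Rightarrow> 'v \<times> 'a \<Rightarrow> 'v \<times> 'a" where
  "mw_map G \<phi> e x = (tail G e, \<phi> e (snd x))"

text \<open>The fibred product \<open>E \<times>\<^sub>G K\<close>, topologised as a subspace of \<open>E \<times> K\<close> with \<open>E\<close> discrete.\<close>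

definition mw_edge_space ::
  "('v, 'e) pre_digraph \<Rightarrow> ('v \<Rightarrow> 'a metric) \<Rightarrow> ('e \<times> ('v \<times> 'a)) topology" where
  "mw_edge_space G K =
    subtopology (prod_topology (discrete_topology (arcs G)) (mw_space G K))
      {(e, x). e \<in> arcs G \<and> x \<in> mw_piece K (head G e)}"

section \<open>Correspondences\<close>

text \<open>
  The two records hold the data of a complex \<open>*\<close>-algebra and of a bimodule over it with an
  algebra-valued inner product. Norms are not recorded, since they play no part in the notion of
  isomorphism.
\<close>

record 'a star_algebra =
  sa_carrier :: "'a set"
  sa_add :: "'a \<Rightarrow> 'a \<Rightarrow> 'a"
  sa_scale :: "complex \<Rightarrow> 'a \<Rightarrow> 'a"
  sa_mult :: "'a \<Rightarrow> 'a \<Rightarrow> 'a"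
  sa_star :: "'a \<Rightarrow> 'a"

record ('a, 'x) correspondence =
  co_algebra :: "'a star_algebra"
  co_carrier :: "'x set"
  co_add :: "'x \<Rightarrow> 'x \<Rightarrow> 'x"
  co_scale :: "complex \<Rightarrow> 'x \<Rightarrow> 'x"
  co_left :: "'a \<Rightarrow> 'x \<Rightarrow> 'x"
  co_right :: "'x \<Rightarrow> 'a \<Rightarrow> 'x"
  co_inner :: "'x \<Rightarrow> 'x \<Rightarrow> 'a"

definition star_isomorphism :: "'a star_algebra \<Rightarrow> 'b star_algebra \<Rightarrow> ('a \<Rightarrow> 'b) \<Rightarrow> bool" where
  "star_isomorphism A B \<alpha> \<longleftrightarrow>
    bij_betw \<alpha> (sa_carrier A) (sa_carrier B) \<and>
    (\<forall>a\<in>sa_carrier A. \<forall>b\<in>sa_carrier A. \<alpha> (sa_add A a b) = sa_add B (\<alpha> a) (\<alpha> b)) \<and>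
    (\<forall>c. \<forall>a\<in>sa_carrier A. \<alpha> (sa_scale A c a) = sa_scale B c (\<alpha> a)) \<and>
    (\<forall>a\<in>sa_carrier A. \<forall>b\<in>sa_carrier A. \<alpha> (sa_mult A a b) = sa_mult B (\<alpha> a) (\<alpha> b)) \<and>
    (\<forall>a\<in>sa_carrier A. \<alpha> (sa_star A a) = sa_star B (\<alpha> a))"

definition correspondence_isomorphism ::
  "('a, 'x) correspondence \<Rightarrow> ('b, 'y) correspondence \<Rightarrow> ('a \<Rightarrow> 'b) \<Rightarrow> ('x \<Rightarrow> 'y) \<Rightarrow> bool" where
  "correspondence_isomorphism X Y \<alpha> V \<longleftrightarrow>
    star_isomorphism (co_algebra X) (co_algebra Y) \<alpha> \<and>
    V ` co_carrier X = co_carrier Y \<and>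
    (\<forall>\<xi>\<in>co_carrier X. \<forall>\<eta>\<in>co_carrier X. V (co_add X \<xi> \<eta>) = co_add Y (V \<xi>) (V \<eta>)) \<and>
    (\<forall>c. \<forall>\<xi>\<in>co_carrier X. V (co_scale X c \<xi>) = co_scale Y c (V \<xi>)) \<and>
    (\<forall>a\<in>sa_carrier (co_algebra X). \<forall>b\<in>sa_carrier (co_algebra X). \<forall>\<xi>\<in>co_carrier X.
      V (co_right X (co_left X a \<xi>) b) = co_right Y (co_left Y (\<alpha> a) (V \<xi>)) (\<alpha> b)) \<and>
    (\<forall>\<xi>\<in>co_carrier X. \<forall>\<eta>\<in>co_carrier X. co_inner Y (V \<xi>) (V \<eta>) = \<alpha> (co_inner X \<xi> \<eta>))"

definition isomorphic_correspondences ::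
  "('a, 'x) correspondence \<Rightarrow> ('b, 'y) correspondence \<Rightarrow> bool" where
  "isomorphic_correspondences X Y \<longleftrightarrow> (\<exists>\<alpha> V. correspondence_isomorphism X Y \<alpha> V)"

text \<open>
  A function on \<open>topspace X\<close> is represented by its extension by \<open>0\<close>, so that equality of elements
  of \<open>C(X)\<close> is equality of functions and all operations are pointwise.
\<close>

definition cfunspace :: "'k topology \<Rightarrow> ('k \<Rightarrow> complex) set" where
  "cfunspace X = {a. continuous_map X euclidean a \<and> (\<forall>x. x \<notin> topspace X \<longrightarrow> a x = 0)}"

definition cfun_algebra :: "'k topology \<Rightarrow> ('k \<Rightarrow> complex) star_algebra" where
  "cfun_algebra X =
    \<lparr> sa_carrier = cfunspace X,
      sa_add = (\<lambda>a b x. a x + b x),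
      sa_scale = (\<lambda>c a x. c * a x),
      sa_mult = (\<lambda>a b x. a x * b x),
      sa_star = (\<lambda>a x. cnj (a x)) \<rparr>"

definition mw_correspondence ::
  "('v, 'e) pre_digraph \<Rightarrow> ('v \<Rightarrow> 'a metric) \<Rightarrow> ('e \<Rightarrow> 'a \<Rightarrow> 'a) \<Rightarrow>
    ('v \<times> 'a \<Rightarrow> complex, 'e \<times> ('v \<times> 'a) \<Rightarrow> complex) correspondence" where
  "mw_correspondence G K \<phi> =
    \<lparr> co_algebra = cfun_algebra (mw_space G K),
      co_carrier = cfunspace (mw_edge_space G K),
      co_add = (\<lambda>\<xi> \<eta> p. \<xi> p + \<eta> p),
      co_scale = (\<lambda>c \<xi> p. c * \<xi> p),
      co_left = (\<lambda>a \<xi> (e, x). a (mw_map G \<phi> e x) * \<xi> (e, x)),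
      co_right = (\<lambda>\<xi> a (e, x). \<xi> (e, x) * a x),
      co_inner = (\<lambda>\<xi> \<eta> x. \<Sum>e\<in>{e \<in> arcs G. x \<in> mw_piece K (head G e)}.
                            cnj (\<xi> (e, x)) * \<eta> (e, x)) \<rparr>"

end

theory Submission
  imports Defs
begin

text \<open>
  By Gelfand duality \<open>\<alpha>\<close> is composition with the inverse of a homeomorphism \<open>f\<close>. In the fibres of the
  correspondences over \<open>x\<close> and \<open>f x\<close>, the map \<open>V\<close> is a unitary matrix \<open>u(x)\<close> with entries indexed by the
  edges \<open>e'\<close> with \<open>f x \<in> K2\<^bsub>r(e')\<^esub>\<close> and \<open>e\<close> with \<open>x \<in> K1\<^bsub>r(e)\<^esub>\<close>. Compatibility with the left actions forces
  \<open>f\<^sup>-\<^sup>1 (\<phi>2 e' (f x)) = \<phi>1 e x\<close> wherever the entry \<open>(e', e)\<close> is nonzero. An invertible matrix has a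
  transversal of nonzero entries, which extends to a permutation of the edges, and its entries
  remain nonzero near \<open>x\<close>. As there are finitely many permutations, the open sets belonging to them
  form a finite cover.
\<close>

section \<open>Isomorphisms of algebras of continuous functions\<close>

lemma continuous_map_euclidean_compose:
  fixes h :: "'b::topological_space \<Rightarrow> 'c::topological_space"
  assumes "continuous_map X euclidean a" "continuous_on UNIV h"
  shows "continuous_map X euclidean (\<lambda>x. h (a x))"
  using continuous_map_compose[OF assms(1), of euclidean h] assms(2) by (simp add: o_def)

lemma continuous_map_mult_normed:
  fixes a b :: "'k \<Rightarrow> 'b::real_normed_algebra"
  assumes "continuous_map X euclidean a" "continuous_map X euclidean b"
  shows "continuous_map X euclidean (\<lambda>x. a x * b x)"
  using assms by (simp add: continuous_map_atin tendsto_mult)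

lemma cfunspace_continuous: "a \<in> cfunspace X \<Longrightarrow> continuous_map X euclidean a"
  and cfunspace_outside: "a \<in> cfunspace X \<Longrightarrow> x \<notin> topspace X \<Longrightarrow> a x = 0"
  by (auto simp: cfunspace_def)

lemma cfunspace_add: "a \<in> cfunspace X \<Longrightarrow> b \<in> cfunspace X \<Longrightarrow> (\<lambda>x. a x + b x) \<in> cfunspace X"
  by (auto simp: cfunspace_def intro: continuous_map_add)

lemma cfunspace_mult: "a \<in> cfunspace X \<Longrightarrow> b \<in> cfunspace X \<Longrightarrow> (\<lambda>x. a x * b x) \<in> cfunspace X"
  by (auto simp: cfunspace_def intro: continuous_map_mult_normed)

lemma cfunspace_scale: "a \<in> cfunspace X \<Longrightarrow> (\<lambda>x. c * a x) \<in> cfunspace X"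
  by (auto simp: cfunspace_def intro: continuous_map_mult_normed)

lemma cfunspace_cnj: "a \<in> cfunspace X \<Longrightarrow> (\<lambda>x. cnj (a x)) \<in> cfunspace X"
  using continuous_map_euclidean_compose[of X a cnj, OF _ continuous_on_cnj[OF continuous_on_id]]
  by (simp add: cfunspace_def)

lemma cfunspace_zero: "(\<lambda>x. 0) \<in> cfunspace X"
  by (simp add: cfunspace_def)

lemma cfunspace_inverse:
  assumes "a \<in> cfunspace X" "\<And>x. x \<in> topspace X \<Longrightarrow> a x \<noteq> 0"
  shows "(\<lambda>x. inverse (a x)) \<in> cfunspace X"
proof -
  have "continuous_map X euclidean (\<lambda>x. inverse (a x))"
    using cfunspace_continuous[OF assms(1)] assms(2)
    unfolding continuous_map_atin limitin_canonical_iff by (blast intro: tendsto_inverse)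
  then show ?thesis using cfunspace_outside[OF assms(1)] by (simp add: cfunspace_def)
qed

text \<open>As \<open>S\<close> is clopen, the preimage of any set is a union of some of
  \<open>S\<close> and its complement.\<close>

lemma cfunspace_indicator:
  assumes "openin X S" "closedin X S"
  shows "indicator S \<in> cfunspace X"
proof -
  have "openin X {x \<in> topspace X. indicator S x \<in> U}" for U :: "complex set"
  proof -
    have "{x \<in> topspace X. indicator S x \<in> U} =
      (if 1 \<in> U then S else {}) \<union> (if 0 \<in> U then topspace X - S else {})"
      using openin_subset[OF assms(1)] by (auto simp: indicator_def split: if_splits)
    then show ?thesis using assms by auto
  qed
  then have "continuous_map X euclidean (indicator S :: _ \<Rightarrow> complex)"
    by (simp add: continuous_map_def)
  then show ?thesis
    using openin_subset[OF assms(1)] by (auto simp: cfunspace_def indicator_def)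
qed

text \<open>Elements vanish off the space, so the unit of C(X) is this indicator and not the
  constant 1.\<close>

lemma cfunspace_unit: "indicator (topspace X) \<in> cfunspace X"
  by (rule cfunspace_indicator) auto

text \<open>Urysohn's lemma for the closed sets \<open>{x}\<close> and
  \<open>topspace X - U\<close>, in complex-valued form.\<close>

lemma cfunspace_bump:
  assumes "compact_space X" "Hausdorff_space X" "openin X U" "x \<in> U"
  shows "\<exists>a\<in>cfunspace X. a x = 1 \<and> (\<forall>y. y \<notin> U \<longrightarrow> a y = 0)"
proof -
  have x: "x \<in> topspace X" using assms openin_subset by blast
  have "normal_space X"
    using assms(1,2) by (simp add: compact_Hausdorff_or_regular_imp_normal_space)
  moreover have "closedin X {x}" using x assms(2) closedin_Hausdorff_singleton by metis
  moreover have "closedin X (topspace X - U)" using assms by blast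
  moreover have "disjnt {x} (topspace X - U)" using assms by auto
  ultimately obtain r :: "'a \<Rightarrow> real" where r: "continuous_map X euclideanreal r"
    "r ` {x} \<subseteq> {1}" "r ` (topspace X - U) \<subseteq> {0}"
    using Urysohn_lemma_alt by metis
  \<comment> \<open>\<open>r\<close> is arbitrary off the space, where an element of
    \<open>cfunspace X\<close> must vanish.\<close>
  define a where "a y = (if y \<in> topspace X then complex_of_real (r y) else 0)" for y
  have "continuous_map X euclidean (\<lambda>y. complex_of_real (r y))"
    by (rule continuous_map_euclidean_compose[OF r(1) continuous_on_of_real[OF continuous_on_id]])
  then have "continuous_map X euclidean a"
    by (rule continuous_map_eq) (simp add: a_def)
  then have "a \<in> cfunspace X" by (simp add: cfunspace_def a_def)
  moreover have "a x = 1" using x r by (simp add: a_def)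
  moreover have "a y = 0" if "y \<notin> U" for y using that r by (auto simp: a_def)
  ultimately show ?thesis by blast
qed

lemma cfunspace_separates:
  assumes "compact_space X" "Hausdorff_space X" "x \<in> topspace X" "y \<in> topspace X"
    and "\<And>a. a \<in> cfunspace X \<Longrightarrow> a x = a y"
  shows "x = y"
proof (rule ccontr)
  assume "x \<noteq> y"
  have "openin X (topspace X - {y})"
    by (intro openin_diff openin_topspace closedin_Hausdorff_singleton assms)
  moreover have "x \<in> topspace X - {y}" using assms(3) \<open>x \<noteq> y\<close> by simp
  ultimately obtain a where "a \<in> cfunspace X" "a x = 1" "\<forall>z. z \<notin> topspace X - {y} \<longrightarrow> a z = 0"
    using cfunspace_bump[OF assms(1,2)] by blast
  then show False using assms(5)[of a] by auto
qed

text \<open>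
  Otherwise the kernel of \<open>\<omega>\<close> contains functions \<open>b\<^sub>x\<close> with \<open>b\<^sub>x x \<noteq> 0\<close>, and by compactness a finite
  sum of the \<open>\<bar>b\<^sub>x\<bar>\<^sup>2\<close> is an invertible element of the kernel.
\<close>
lemma cfunspace_character:
  fixes \<omega> :: "('k \<Rightarrow> complex) \<Rightarrow> complex"
  assumes comp: "compact_space X"
    and unit: "\<omega> (indicator (topspace X)) = 1"
    and add: "\<And>a b. a \<in> cfunspace X \<Longrightarrow> b \<in> cfunspace X \<Longrightarrow> \<omega> (\<lambda>x. a x + b x) = \<omega> a + \<omega> b"
    and scale: "\<And>c a. a \<in> cfunspace X \<Longrightarrow> \<omega> (\<lambda>x. c * a x) = c * \<omega> a"
    and mult: "\<And>a b. a \<in> cfunspace X \<Longrightarrow> b \<in> cfunspace X \<Longrightarrow> \<omega> (\<lambda>x. a x * b x) = \<omega> a * \<omega> b"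
  shows "\<exists>x\<in>topspace X. \<forall>a\<in>cfunspace X. \<omega> a = a x"
proof (rule ccontr)
  assume no_point: "\<not> ?thesis"
  have "\<exists>b\<in>cfunspace X. \<omega> b = 0 \<and> b x \<noteq> 0" if x: "x \<in> topspace X" for x
  proof -
    obtain a where a: "a \<in> cfunspace X" "\<omega> a \<noteq> a x" using no_point x by blast
    \<comment> \<open>Subtracting \<open>\<omega> a\<close> times the unit puts \<open>a\<close>
      into the kernel and leaves the nonzero value \<open>a x - \<omega> a\<close> at
      \<open>x\<close>.\<close>
    let ?b = "\<lambda>y. a y + (- \<omega> a) * indicator (topspace X) y"
    have "?b \<in> cfunspace X"
      by (intro cfunspace_add cfunspace_scale cfunspace_unit a)
    moreover have "\<omega> ?b = 0"
      unfolding add[OF a(1) cfunspace_scale[OF cfunspace_unit]] scale[OF cfunspace_unit] unit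
      by simp
    moreover have "?b x \<noteq> 0" using x a(2) by simp
    ultimately show ?thesis by blast
  qed
  then obtain b where b: "\<And>x. x \<in> topspace X \<Longrightarrow> b x \<in> cfunspace X \<and> \<omega> (b x) = 0 \<and> b x x \<noteq> 0"
    by metis
  define U where "U x = {y \<in> topspace X. b x y \<noteq> 0}" for x
  have "openin X (U x)" if "x \<in> topspace X" for x
    using openin_continuous_map_preimage[OF cfunspace_continuous, of "b x" X "- {0}"] b[OF that]
    by (simp add: U_def open_Compl)
  moreover have "topspace X \<subseteq> \<Union> (U ` topspace X)" using b by (auto simp: U_def)
  ultimately obtain \<F> where \<F>: "finite \<F>" "\<F> \<subseteq> U ` topspace X" "topspace X \<subseteq> \<Union> \<F>"
    using comp unfolding compact_space_alt by (metis (no_types, lifting) imageE)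
  then obtain F where F: "finite F" "F \<subseteq> topspace X" "topspace X \<subseteq> (\<Union>x\<in>F. U x)"
    by (metis finite_subset_image)
  define g where "g y = (\<Sum>x\<in>F. cnj (b x y) * b x y)" for y
  \<comment> \<open>The kernel is closed under sums and under products with arbitrary elements, here
    with the conjugate of \<open>b x\<close>.\<close>
  have "(\<lambda>y. \<Sum>x\<in>H. cnj (b x y) * b x y) \<in> cfunspace X \<and>
        \<omega> (\<lambda>y. \<Sum>x\<in>H. cnj (b x y) * b x y) = 0" if "finite H" "H \<subseteq> topspace X" for H
    using that
  proof (induction H)
    case empty
    show ?case using scale[OF cfunspace_zero, of 0] by (simp add: cfunspace_zero)
  next
    case (insert x H)
    then have bx: "b x \<in> cfunspace X" "\<omega> (b x) = 0" using b by auto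
    then have "(\<lambda>y. cnj (b x y) * b x y) \<in> cfunspace X" "\<omega> (\<lambda>y. cnj (b x y) * b x y) = 0"
      by (auto intro: cfunspace_mult cfunspace_cnj simp: mult[OF cfunspace_cnj])
    then show ?case using insert by (simp add: add cfunspace_add)
  qed
  then have g: "g \<in> cfunspace X" "\<omega> g = 0" using F by (auto simp: g_def[abs_def])
  have "g y \<noteq> 0" if y: "y \<in> topspace X" for y
  proof
    assume "g y = 0"
    moreover have "complex_of_real (\<Sum>x\<in>F. (cmod (b x y))\<^sup>2) = g y"
      unfolding g_def of_real_sum
      by (intro sum.cong refl) (simp only: complex_norm_square mult.commute)
    ultimately have "(\<Sum>x\<in>F. (cmod (b x y))\<^sup>2) = 0" by (metis of_real_eq_0_iff)
    then have "\<forall>x\<in>F. b x y = 0" using F(1) by (simp add: sum_nonneg_eq_0_iff)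
    then show False using F(3) y by (auto simp: U_def)
  qed
  moreover from this have "(\<lambda>y. g y * inverse (g y)) = indicator (topspace X)"
    using cfunspace_outside[OF g(1)] by (auto simp: indicator_def fun_eq_iff)
  ultimately show False
    using mult[OF g(1) cfunspace_inverse[OF g(1)]] g(2) unit by simp
qed

text \<open>The record carries no algebra axioms, so closure under the operations is assumed. With
  it, each law for the inverse follows from the law for \<open>\<alpha>\<close> by
  injectivity.\<close>

lemma star_isomorphism_inv_into:
  assumes "star_isomorphism A B \<alpha>"
    and "\<And>a b. a \<in> sa_carrier A \<Longrightarrow> b \<in> sa_carrier A \<Longrightarrow> sa_add A a b \<in> sa_carrier A"
    and "\<And>c a. a \<in> sa_carrier A \<Longrightarrow> sa_scale A c a \<in> sa_carrier A"
    and "\<And>a b. a \<in> sa_carrier A \<Longrightarrow> b \<in> sa_carrier A \<Longrightarrow> sa_mult A a b \<in> sa_carrier A"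
    and "\<And>a. a \<in> sa_carrier A \<Longrightarrow> sa_star A a \<in> sa_carrier A"
  shows "star_isomorphism B A (inv_into (sa_carrier A) \<alpha>)"
proof -
  let ?\<beta> = "inv_into (sa_carrier A) \<alpha>"
  have bij: "bij_betw \<alpha> (sa_carrier A) (sa_carrier B)"
    using assms(1) by (simp add: star_isomorphism_def)
  then have \<beta>: "?\<beta> b \<in> sa_carrier A" "\<alpha> (?\<beta> b) = b" if "b \<in> sa_carrier B" for b
    using that by (metis bij_betw_def inv_into_into, metis bij_betw_inv_into_right)
  have eq: "?\<beta> b = a" if "a \<in> sa_carrier A" "\<alpha> a = b" for a b
    using bij that by (metis bij_betw_inv_into_left)
  show ?thesis
    unfolding star_isomorphism_def
    using bij_betw_inv_into[OF bij] assms
    by (auto simp: star_isomorphism_def \<beta> intro!: eq)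
qed

text \<open>Evaluation at \<open>y\<close> after \<open>\<alpha>\<close> is a character of C(X),
  hence evaluation at a point.\<close>

lemma star_isomorphism_cfun_point:
  assumes "compact_space X" "star_isomorphism (cfun_algebra X) (cfun_algebra Y) \<alpha>" "y \<in> topspace Y"
  shows "\<exists>x\<in>topspace X. \<forall>a\<in>cfunspace X. \<alpha> a y = a x"
proof -
  have hom: "\<And>a b. a \<in> cfunspace X \<Longrightarrow> b \<in> cfunspace X \<Longrightarrow> \<alpha> (\<lambda>x. a x + b x) y = \<alpha> a y + \<alpha> b y"
    "\<And>c a. a \<in> cfunspace X \<Longrightarrow> \<alpha> (\<lambda>x. c * a x) y = c * \<alpha> a y"
    "\<And>a b. a \<in> cfunspace X \<Longrightarrow> b \<in> cfunspace X \<Longrightarrow> \<alpha> (\<lambda>x. a x * b x) y = \<alpha> a y * \<alpha> b y"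
    and bij: "bij_betw \<alpha> (cfunspace X) (cfunspace Y)"
    using assms(2) by (auto simp: star_isomorphism_def cfun_algebra_def)
  \<comment> \<open>That \<open>\<alpha>\<close> preserves the unit comes from surjectivity: if
    \<open>e\<close> is mapped to the unit, applying \<open>\<alpha>\<close> to the product of
    \<open>e\<close> with the unit and evaluating at \<open>y\<close> gives the value 1.\<close>
  obtain e where e: "e \<in> cfunspace X" "\<alpha> e = indicator (topspace Y)"
    using bij cfunspace_unit[of Y] by (metis bij_betw_imp_surj_on imageE)
  have "(\<lambda>x. e x * indicator (topspace X) x) = e"
    using cfunspace_outside[OF e(1)] by (auto simp: indicator_def fun_eq_iff)
  then have "\<alpha> (indicator (topspace X)) y = 1"
    using hom(3)[OF e(1) cfunspace_unit] e(2) assms(3) by simp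
  then show ?thesis
    by (intro cfunspace_character[OF assms(1)] hom)
qed

text \<open>On a compact Hausdorff space the sets where some element of C(X) is nonzero form a base,
  so continuity can be tested after composition with such functions.\<close>

lemma continuous_map_via_cfunspace:
  assumes "compact_space X" "Hausdorff_space X" "h \<in> topspace Y \<rightarrow> topspace X"
    and "\<And>a. a \<in> cfunspace X \<Longrightarrow> continuous_map Y euclidean (\<lambda>y. a (h y))"
  shows "continuous_map Y X h"
  unfolding continuous_map_def
proof (intro conjI allI impI assms(3))
  fix U assume U: "openin X U"
  show "openin Y {y \<in> topspace Y. h y \<in> U}"
  proof (subst openin_subopen, safe)
    fix y assume y: "y \<in> topspace Y" "h y \<in> U"
    obtain a where a: "a \<in> cfunspace X" "a (h y) = 1" "\<forall>x. x \<notin> U \<longrightarrow> a x = 0"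
      using cfunspace_bump[OF assms(1,2) U y(2)] by blast
    have "openin Y {y \<in> topspace Y. a (h y) \<in> - {0}}"
      by (rule openin_continuous_map_preimage[OF assms(4)[OF a(1)]]) auto
    moreover have "{y \<in> topspace Y. a (h y) \<in> - {0}} \<subseteq> {y \<in> topspace Y. h y \<in> U}"
      using a(3) by auto
    ultimately show "\<exists>T. openin Y T \<and> y \<in> T \<and> T \<subseteq> {y \<in> topspace Y. h y \<in> U}"
      using y a(2) by (intro exI conjI) auto
  qed
qed

text \<open>The points representing the characters given by \<open>\<alpha>\<close> at each
  \<open>y\<close> are collected into \<open>h\<close>, which runs against the direction of
  \<open>\<alpha>\<close>. Continuity follows because each \<open>\<alpha> a\<close> is
  continuous.\<close>

lemma star_isomorphism_cfun_map:
  assumes "compact_space X" "Hausdorff_space X"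
    and "star_isomorphism (cfun_algebra X) (cfun_algebra Y) \<alpha>"
  obtains h where "continuous_map Y X h"
    "\<And>a y. a \<in> cfunspace X \<Longrightarrow> y \<in> topspace Y \<Longrightarrow> \<alpha> a y = a (h y)"
proof -
  obtain h where h: "\<And>y. y \<in> topspace Y \<Longrightarrow> h y \<in> topspace X"
    "\<And>a y. a \<in> cfunspace X \<Longrightarrow> y \<in> topspace Y \<Longrightarrow> \<alpha> a y = a (h y)"
    using star_isomorphism_cfun_point[OF assms(1,3)] by metis
  have "continuous_map Y X h"
  proof (rule continuous_map_via_cfunspace[OF assms(1,2)])
    fix a assume a: "a \<in> cfunspace X"
    then have "\<alpha> a \<in> cfunspace Y"
      using assms(3) by (auto simp: star_isomorphism_def cfun_algebra_def bij_betw_def)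
    then show "continuous_map Y euclidean (\<lambda>y. a (h y))"
      using h(2)[OF a] by (metis (no_types, lifting) cfunspace_continuous continuous_map_eq)
  qed (use h in auto)
  with h that show ?thesis by blast
qed

text \<open>\<open>g\<close> comes from \<open>\<alpha>\<close> and \<open>f\<close> from its
  inverse. Their composites leave every continuous function unchanged, and these functions separate
  points.\<close>

theorem star_isomorphism_cfun_homeomorphism:
  assumes X: "compact_space X" "Hausdorff_space X" and Y: "compact_space Y" "Hausdorff_space Y"
    and \<alpha>: "star_isomorphism (cfun_algebra X) (cfun_algebra Y) \<alpha>"
  obtains f g where "homeomorphic_maps X Y f g"
    "\<And>a x. a \<in> cfunspace X \<Longrightarrow> x \<in> topspace X \<Longrightarrow> \<alpha> a (f x) = a x"
proof -
  define \<beta> where "\<beta> = inv_into (cfunspace X) \<alpha>"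
  have bij: "bij_betw \<alpha> (cfunspace X) (cfunspace Y)"
    using \<alpha> by (simp add: star_isomorphism_def cfun_algebra_def)
  have "star_isomorphism (cfun_algebra Y) (cfun_algebra X) \<beta>"
    using star_isomorphism_inv_into[OF \<alpha>]
    by (simp add: \<beta>_def cfun_algebra_def cfunspace_add cfunspace_scale cfunspace_mult cfunspace_cnj)
  then obtain f where f: "continuous_map X Y f"
    "\<And>b x. b \<in> cfunspace Y \<Longrightarrow> x \<in> topspace X \<Longrightarrow> \<beta> b x = b (f x)"
    using star_isomorphism_cfun_map[OF Y] by metis
  obtain g where g: "continuous_map Y X g"
    "\<And>a y. a \<in> cfunspace X \<Longrightarrow> y \<in> topspace Y \<Longrightarrow> \<alpha> a y = a (g y)"
    using star_isomorphism_cfun_map[OF X \<alpha>] by metis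
  have fg_in: "f x \<in> topspace Y" "g y \<in> topspace X" if "x \<in> topspace X" "y \<in> topspace Y" for x y
    using f(1) g(1) that by (auto simp: continuous_map_def)
  have \<alpha>\<beta>: "\<And>a. a \<in> cfunspace X \<Longrightarrow> \<alpha> a \<in> cfunspace Y \<and> \<beta> (\<alpha> a) = a"
    "\<And>b. b \<in> cfunspace Y \<Longrightarrow> \<beta> b \<in> cfunspace X \<and> \<alpha> (\<beta> b) = b"
    using bij unfolding \<beta>_def
    by (auto simp: bij_betw_inv_into_left bij_betw_inv_into_right
        bij_betwE bij_betw_inv_into[THEN bij_betwE, rule_format])
  have eval: "\<alpha> a (f x) = a x" if "a \<in> cfunspace X" "x \<in> topspace X" for a x
    using f(2)[of "\<alpha> a" x] \<alpha>\<beta>(1) that by simp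
  have "g (f x) = x" if x: "x \<in> topspace X" for x
    by (rule cfunspace_separates[OF X])
      (use x f(1) g eval fg_in in \<open>auto simp: continuous_map_def Pi_iff\<close>)
  moreover have "f (g y) = y" if y: "y \<in> topspace Y" for y
  proof (rule cfunspace_separates[OF Y])
    have gy: "g y \<in> topspace X" using g(1) y by (auto simp: continuous_map_def)
    then show "f (g y) \<in> topspace Y" using f(1) by (auto simp: continuous_map_def)
    fix b assume "b \<in> cfunspace Y"
    then show "b (f (g y)) = b y" using f(2)[OF _ gy] g(2)[OF _ y] \<alpha>\<beta>(2) by metis
  qed (rule y)
  ultimately have "homeomorphic_maps X Y f g"
    using f(1) g(1) by (simp add: homeomorphic_maps_def)
  with eval that show ?thesis by blast
qed

section \<open>Transversals of unitary matrices\<close>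

text \<open>
  Laplace expansion without determinants: if deleting column \<open>b\<close> destroyed the independence of the
  rows in \<open>A\<close> for every \<open>b\<close> with \<open>u a\<^sub>0 b \<noteq> 0\<close>, all these unit vectors would lie in the span of the
  rows in \<open>A\<close>, and so would the row \<open>a\<^sub>0\<close>.
\<close>
lemma independent_rows_transversal:
  fixes u :: "'a \<Rightarrow> 'b \<Rightarrow> 'c::field"
  assumes "finite A" "finite B"
    and "\<And>c. \<forall>b\<in>B. (\<Sum>a\<in>A. c a * u a b) = 0 \<Longrightarrow> \<forall>a\<in>A. c a = 0"
  shows "\<exists>\<sigma>. inj_on \<sigma> A \<and> \<sigma> ` A \<subseteq> B \<and> (\<forall>a\<in>A. u a (\<sigma> a) \<noteq> 0)"
  using assms
proof (induction A arbitrary: B rule: finite_induct)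
  case (insert a0 A)
  have indep_A: "\<forall>a\<in>A. c a = 0" if "\<forall>b\<in>B. (\<Sum>a\<in>A. c a * u a b) = 0" for c
  proof -
    have "(\<Sum>a\<in>insert a0 A. (c(a0 := 0)) a * u a b) = (\<Sum>a\<in>A. c a * u a b)" for b
      using insert.hyps by (auto intro!: sum.cong)
    then have "\<forall>a\<in>insert a0 A. (c(a0 := 0)) a = 0"
      using that insert.prems(2)[of "c(a0 := 0)"] by simp
    then show ?thesis using insert.hyps by (metis fun_upd_other insertCI)
  qed
  \<comment> \<open>This is the premise of the induction hypothesis for the columns
    \<open>B - {b}\<close>.\<close>
  define indep where "indep b \<longleftrightarrow>
    (\<forall>c. (\<forall>b'\<in>B - {b}. (\<Sum>a\<in>A. c a * u a b') = 0) \<longrightarrow> (\<forall>a\<in>A. c a = 0))" for b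
  have "\<exists>b\<in>B. u a0 b \<noteq> 0 \<and> indep b"
  proof (rule ccontr)
    assume neg: "\<not> ?thesis"
    define S where "S = {b \<in> B. u a0 b \<noteq> 0}"
    have "\<exists>d. \<forall>b'\<in>B. (\<Sum>a\<in>A. d a * u a b') = (if b' = b then 1 else 0)" if "b \<in> S" for b
    proof -
      have "\<not> indep b" using neg that unfolding S_def by blast
      then obtain c where c: "\<forall>b'\<in>B - {b}. (\<Sum>a\<in>A. c a * u a b') = 0" "\<not> (\<forall>a\<in>A. c a = 0)"
        unfolding indep_def by meson
      \<comment> \<open>The combination vanishes in every column except \<open>b\<close>, where its
        value cannot be 0; dividing by \<open>s\<close> gives the unit vector at
        \<open>b\<close>.\<close>
      define s where "s = (\<Sum>a\<in>A. c a * u a b)"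
      have "s \<noteq> 0"
      proof
        assume "s = 0"
        then have "\<forall>b'\<in>B. (\<Sum>a\<in>A. c a * u a b') = 0" using c(1) s_def by (metis DiffI singletonD)
        then show False using indep_A c(2) by blast
      qed
      have "(\<Sum>a\<in>A. c a / s * u a b') = (\<Sum>a\<in>A. c a * u a b') / s" for b'
        by (simp add: sum_divide_distrib)
      then have "\<forall>b'\<in>B. (\<Sum>a\<in>A. c a / s * u a b') = (if b' = b then 1 else 0)"
        using c(1) \<open>s \<noteq> 0\<close> by (auto simp: s_def)
      then show ?thesis by (rule exI[of _ "\<lambda>a. c a / s"])
    qed
    then have "\<forall>b\<in>S. \<exists>d. \<forall>b'\<in>B. (\<Sum>a\<in>A. d a * u a b') = (if b' = b then 1 else 0)"
      by blast
    from bchoice[OF this] obtain d where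
      d: "\<forall>b\<in>S. \<forall>b'\<in>B. (\<Sum>a\<in>A. d b a * u a b') = (if b' = b then 1 else 0)"
      by blast
    \<comment> \<open>Row \<open>a0\<close> is the sum over \<open>S\<close> of
      \<open>u a0 b\<close> times the unit vector at \<open>b\<close>; \<open>e\<close> is this
      dependence with row \<open>a0\<close> moved to the other side, hence
      \<open>- 1\<close>.\<close>
    define e where "e a = (if a = a0 then - 1 else (\<Sum>b\<in>S. u a0 b * d b a))" for a
    have "(\<Sum>a\<in>insert a0 A. e a * u a b') = 0" if b': "b' \<in> B" for b'
    proof -
      have "(\<Sum>a\<in>A. e a * u a b') = (\<Sum>a\<in>A. \<Sum>b\<in>S. u a0 b * (d b a * u a b'))"
        using insert.hyps by (intro sum.cong) (auto simp: e_def sum_distrib_right mult.assoc)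
      also have "\<dots> = (\<Sum>b\<in>S. u a0 b * (\<Sum>a\<in>A. d b a * u a b'))"
        by (subst sum.swap) (simp add: sum_distrib_left)
      also have "\<dots> = (\<Sum>b\<in>S. if b' = b then u a0 b else 0)"
        using d b' by (intro sum.cong) auto
      also have "\<dots> = u a0 b'"
        using insert.prems(1) b' by (auto simp: S_def)
      finally show ?thesis using insert.hyps by (simp add: e_def)
    qed
    then have "e a0 = 0" using insert.prems(2)[of e] by blast
    then show False by (simp add: e_def)
  qed
  then obtain b where b: "b \<in> B" "u a0 b \<noteq> 0" "indep b" by blast
  then obtain \<sigma> where \<sigma>: "inj_on \<sigma> A" "\<sigma> ` A \<subseteq> B - {b}" "\<forall>a\<in>A. u a (\<sigma> a) \<noteq> 0"
    using insert.IH[of "B - {b}"] insert.prems(1) unfolding indep_def by auto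
  have "inj_on (\<sigma>(a0 := b)) (insert a0 A)"
    using \<sigma> insert.hyps by (auto simp: inj_on_def)
  moreover have "(\<sigma>(a0 := b)) ` insert a0 A \<subseteq> B" using \<sigma> b by auto
  moreover have "\<forall>a\<in>insert a0 A. u a ((\<sigma>(a0 := b)) a) \<noteq> 0" using \<sigma> b by auto
  ultimately show ?case by blast
qed simp

text \<open>Orthonormal rows are independent, which gives an injective transversal; equal
  cardinalities make it onto \<open>B\<close>.\<close>

lemma unitary_matrix_transversal:
  fixes u :: "'a \<Rightarrow> 'b \<Rightarrow> complex"
  assumes fin: "finite A" "finite B"
    and rows: "\<And>a a'. a \<in> A \<Longrightarrow> a' \<in> A \<Longrightarrow>
      (\<Sum>b\<in>B. u a b * cnj (u a' b)) = (if a = a' then 1 else 0)"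
    and cols: "\<And>b b'. b \<in> B \<Longrightarrow> b' \<in> B \<Longrightarrow>
      (\<Sum>a\<in>A. cnj (u a b) * u a b') = (if b = b' then 1 else 0)"
  shows "\<exists>\<sigma>. bij_betw \<sigma> A B \<and> (\<forall>a\<in>A. u a (\<sigma> a) \<noteq> 0)"
proof -
  have "\<forall>a\<in>A. c a = 0" if c: "\<forall>b\<in>B. (\<Sum>a\<in>A. c a * u a b) = 0" for c
  proof
    fix a' assume a': "a' \<in> A"
    \<comment> \<open>Pairing the relation with row \<open>a'\<close> isolates its
      coefficient.\<close>
    have "0 = (\<Sum>b\<in>B. (\<Sum>a\<in>A. c a * u a b) * cnj (u a' b))" using c by simp
    also have "\<dots> = (\<Sum>b\<in>B. \<Sum>a\<in>A. c a * (u a b * cnj (u a' b)))"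
      by (simp add: sum_distrib_right mult.assoc)
    also have "\<dots> = (\<Sum>a\<in>A. c a * (\<Sum>b\<in>B. u a b * cnj (u a' b)))"
      by (subst sum.swap) (simp add: sum_distrib_left)
    also have "\<dots> = (\<Sum>a\<in>A. if a = a' then c a else 0)"
      using rows a' by (intro sum.cong) auto
    also have "\<dots> = c a'" using fin a' by simp
    finally show "c a' = 0" by simp
  qed
  from independent_rows_transversal[OF fin this]
  obtain \<sigma> where \<sigma>: "inj_on \<sigma> A" "\<sigma> ` A \<subseteq> B" "\<forall>a\<in>A. u a (\<sigma> a) \<noteq> 0"
    by blast
  \<comment> \<open>The sum of all squared moduli is \<open>card A\<close> by rows and
    \<open>card B\<close> by columns.\<close>
  have "of_nat (card A) = (\<Sum>a\<in>A. \<Sum>b\<in>B. u a b * cnj (u a b))"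
    using rows by simp
  also have "\<dots> = (\<Sum>b\<in>B. \<Sum>a\<in>A. cnj (u a b) * u a b)"
    by (subst sum.swap) (simp add: mult.commute)
  also have "\<dots> = (of_nat (card B) :: complex)"
    using cols by simp
  finally have "card A = card B" by (simp only: of_nat_eq_iff)
  then have "\<sigma> ` A = B"
    using \<sigma> fin by (intro card_subset_eq) (auto simp: card_image)
  then show ?thesis using \<sigma> by (auto simp: bij_betw_def)
qed

text \<open>The complements of \<open>A\<close> and \<open>B\<close> in \<open>S\<close> have the
  same size, so any bijection between them completes \<open>\<sigma>\<close>.\<close>

lemma bij_betw_extend_permutes:
  assumes "finite S" "A \<subseteq> S" "B \<subseteq> S" "bij_betw \<sigma> A B"
  obtains p where "p permutes S" "\<And>a. a \<in> A \<Longrightarrow> p a = \<sigma> a"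
proof -
  have "card (S - A) = card (S - B)"
    using assms bij_betw_same_card by (metis card_Diff_subset finite_subset)
  then obtain \<tau> where \<tau>: "bij_betw \<tau> (S - A) (S - B)"
    using assms(1) by (meson finite_Diff finite_same_card_bij)
  define p where "p x = (if x \<in> A then \<sigma> x else if x \<in> S then \<tau> x else x)" for x
  have "bij_betw p A B"
    using assms(4) by (rule bij_betw_cong[THEN iffD1, rotated]) (simp add: p_def)
  moreover have "bij_betw p (S - A) (S - B)"
    using \<tau> by (rule bij_betw_cong[THEN iffD1, rotated]) (simp add: p_def)
  ultimately have "bij_betw p (A \<union> (S - A)) (B \<union> (S - B))"
    by (rule bij_betw_combine) auto
  moreover have "A \<union> (S - A) = S" "B \<union> (S - B) = S" using assms by auto
  ultimately have "bij_betw p S S" by simp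
  then have "p permutes S"
    by (rule bij_imp_permutes) (use assms(2) in \<open>auto simp: p_def\<close>)
  then show ?thesis using that by (auto simp: p_def)
qed

section \<open>Spaces of a Mauldin-Williams graph\<close>

lemma continuous_map_from_sum_topology:
  assumes "\<And>i. i \<in> I \<Longrightarrow> continuous_map (X i) Y (\<lambda>x. f (i, x))"
  shows "continuous_map (sum_topology X I) Y f"
  using assms by (fastforce simp: continuous_map_def openin_sum_topology)

lemma compact_space_sum_topology:
  assumes "finite I" "\<And>i. i \<in> I \<Longrightarrow> compact_space (X i)"
  shows "compact_space (sum_topology X I)"
proof -
  have "compactin (sum_topology X I) (\<Union>i\<in>I. Pair i ` topspace (X i))"
    using assms continuous_map_component_injection
    by (intro compactin_Union) (auto simp: compact_space_def intro!: image_compactin)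
  moreover have "(\<Union>i\<in>I. Pair i ` topspace (X i)) = topspace (sum_topology X I)"
    by auto
  ultimately show ?thesis by (simp add: compact_space_def)
qed

text \<open>Points of different summands are separated by the summands, which are open; within one
  summand its own separating sets are transported.\<close>

lemma Hausdorff_space_sum_topology:
  assumes "\<And>i. i \<in> I \<Longrightarrow> Hausdorff_space (X i)"
  shows "Hausdorff_space (sum_topology X I)"
  unfolding Hausdorff_space_def
proof (intro allI impI)
  fix p q
  assume pq: "p \<in> topspace (sum_topology X I) \<and> q \<in> topspace (sum_topology X I) \<and> p \<noteq> q"
  obtain i x j y where eq: "p = (i, x)" "q = (j, y)" by (metis surj_pair)
  with pq have *: "(i, x) \<in> topspace (sum_topology X I)" "(j, y) \<in> topspace (sum_topology X I)"
    "(i, x) \<noteq> (j, y)" by auto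
  have open_Pair: "openin (sum_topology X I) (Pair k ` U)" if "k \<in> I" "openin (X k) U" for k U
    using that open_map_component_injection by (metis open_map_def)
  show "\<exists>U V. openin (sum_topology X I) U \<and> openin (sum_topology X I) V \<and>
      p \<in> U \<and> q \<in> V \<and> disjnt U V"
  proof (cases "i = j")
    case True
    then have "i \<in> I" "x \<in> topspace (X i)" "y \<in> topspace (X i)" "x \<noteq> y" using * by auto
    then obtain U V where "openin (X i) U" "openin (X i) V" "x \<in> U" "y \<in> V" "disjnt U V"
      using assms[of i] unfolding Hausdorff_space_def by blast
    then have "openin (sum_topology X I) (Pair i ` U) \<and> openin (sum_topology X I) (Pair i ` V) \<and>
        p \<in> Pair i ` U \<and> q \<in> Pair i ` V \<and> disjnt (Pair i ` U) (Pair i ` V)"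
      using * True by (auto simp: eq open_Pair disjnt_iff)
    then show ?thesis by blast
  next
    case False
    then have "openin (sum_topology X I) (Pair i ` topspace (X i)) \<and>
        openin (sum_topology X I) (Pair j ` topspace (X j)) \<and>
        p \<in> Pair i ` topspace (X i) \<and> q \<in> Pair j ` topspace (X j) \<and>
        disjnt (Pair i ` topspace (X i)) (Pair j ` topspace (X j))"
      using * by (auto simp: eq open_Pair disjnt_iff)
    then show ?thesis by blast
  qed
qed

section \<open>The vertex space and its clopen pieces\<close>

lemma topspace_mw_space: "topspace (mw_space G K) = (\<Union>v\<in>verts G. mw_piece K v)"
  by (auto simp: mw_space_def mw_piece_def)

lemma mw_piece_eq_image: "mw_piece K v = Pair v ` topspace (mtopology_of (K v))"
  by (auto simp: mw_piece_def)

lemma openin_mw_piece: "v \<in> verts G \<Longrightarrow> openin (mw_space G K) (mw_piece K v)"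
  unfolding mw_space_def mw_piece_eq_image
  using open_map_component_injection[of v "verts G" "\<lambda>v. mtopology_of (K v)"] openin_topspace
  unfolding open_map_def by blast

lemma closedin_mw_piece: "v \<in> verts G \<Longrightarrow> closedin (mw_space G K) (mw_piece K v)"
  unfolding mw_space_def mw_piece_eq_image
  using closed_map_component_injection[of v "verts G" "\<lambda>v. mtopology_of (K v)"] closedin_topspace
  unfolding closed_map_def by blast

text \<open>The standard basis section of the edge \<open>e\<close>: over each point of its piece,
  the unit vector of the fibre in coordinate \<open>e\<close>.\<close>

definition edge_unit ::
  "('v, 'e) pre_digraph \<Rightarrow> ('v \<Rightarrow> 'a metric) \<Rightarrow> 'e \<Rightarrow> 'e \<times> ('v \<times> 'a) \<Rightarrow> complex" where
  "edge_unit G K e = indicator ({e} \<times> mw_piece K (head G e))"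

context mauldin_williams_graph
begin

lemma compact_space_mw_space: "compact_space (mw_space G K)"
  unfolding mw_space_def by (intro compact_space_sum_topology compact_K finite_verts)

lemma Hausdorff_space_mw_space: "Hausdorff_space (mw_space G K)"
  unfolding mw_space_def mtopology_of_def
  by (intro Hausdorff_space_sum_topology Metric_space.Hausdorff_space_mtopology
      Metric_space_mspace_mdist)

lemma topspace_mw_edge_space:
  "topspace (mw_edge_space G K) = {(e, x). e \<in> arcs G \<and> x \<in> mw_piece K (head G e)}"
  using head_in_verts by (fastforce simp: mw_edge_space_def topspace_mw_space)

lemma mw_map_in_topspace:
  assumes "e \<in> arcs G" "x \<in> mw_piece K (head G e)"
  shows "mw_map G \<phi> e x \<in> topspace (mw_space G K)"
  using assms maps_\<phi>[of e] tail_in_verts[of e]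
  by (auto simp: topspace_mw_space mw_piece_def mw_map_def)

lemma continuous_map_\<phi>:
  assumes "e \<in> arcs G"
  shows "continuous_map (mtopology_of (K (head G e))) (mtopology_of (K (tail G e))) (\<phi> e)"
proof (rule Lipschitz_continuous_imp_continuous_map)
  show "Lipschitz_continuous_map (K (head G e)) (K (tail G e)) (\<phi> e)"
    using lipschitz_\<phi> maps_\<phi>[OF assms] assms unfolding Lipschitz_continuous_map_def by meson
qed

text \<open>The right multiplier that imitates the left action of \<open>a\<close> on the basis
  section of \<open>e\<close>. Cutting off outside a whole summand preserves continuity.\<close>

lemma cfunspace_pullback:
  assumes e: "e \<in> arcs G" and a: "a \<in> cfunspace (mw_space G K)"
  shows "(\<lambda>x. indicator (mw_piece K (head G e)) x * a (mw_map G \<phi> e x)) \<in> cfunspace (mw_space G K)"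
proof -
  have "continuous_map (mtopology_of (K v)) euclidean
      (\<lambda>y. indicator (mw_piece K (head G e)) (v, y) * a (mw_map G \<phi> e (v, y)))"
    if "v \<in> verts G" for v
  proof (cases "v = head G e")
    case True
    have "continuous_map (mtopology_of (K v)) euclidean (a \<circ> (Pair (tail G e) \<circ> \<phi> e))"
      using continuous_map_\<phi>[OF e] True cfunspace_continuous[OF a] e
        continuous_map_component_injection[of "tail G e" "verts G" "\<lambda>v. mtopology_of (K v)"]
      by (auto simp: mw_space_def intro!: continuous_map_compose)
    then show ?thesis
      by (rule continuous_map_eq) (use True in \<open>auto simp: mw_piece_def mw_map_def\<close>)
  next
    case False
    then show ?thesis by (simp add: mw_piece_def indicator_def)
  qed
  then have "continuous_map (mw_space G K) euclidean
      (\<lambda>x. indicator (mw_piece K (head G e)) x * a (mw_map G \<phi> e x))"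
    unfolding mw_space_def by (rule continuous_map_from_sum_topology)
  then show ?thesis
    using e by (auto simp: cfunspace_def topspace_mw_space indicator_def)
qed

text \<open>Sections are studied edge by edge as functions on the vertex space. The slice is 0 on
  every summand other than that of \<open>head G e\<close>.\<close>

lemma cfunspace_slice:
  assumes e: "e \<in> arcs G" and \<eta>: "\<eta> \<in> cfunspace (mw_edge_space G K)"
  shows "(\<lambda>x. \<eta> (e, x)) \<in> cfunspace (mw_space G K)"
proof -
  have outside: "\<eta> (e, x) = 0" if "x \<notin> mw_piece K (head G e)" for x
    using that cfunspace_outside[OF \<eta>] by (simp add: topspace_mw_edge_space)
  have "continuous_map (mtopology_of (K v)) euclidean (\<lambda>y. \<eta> (e, (v, y)))"
    if v: "v \<in> verts G" for v
  proof (cases "v = head G e")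
    case True
    have "continuous_map (mtopology_of (K v)) (mw_edge_space G K) (\<lambda>y. (e, (v, y)))"
      unfolding mw_edge_space_def mw_space_def
      using v e True continuous_map_component_injection[of v "verts G" "\<lambda>v. mtopology_of (K v)"]
      by (intro continuous_map_into_subtopology continuous_map_pairedI)
        (auto simp: mw_piece_def)
    from continuous_map_compose[OF this cfunspace_continuous[OF \<eta>]]
    show ?thesis by (simp add: o_def)
  next
    case False
    then show ?thesis by (simp add: outside mw_piece_def)
  qed
  then have "continuous_map (mw_space G K) euclidean (\<lambda>x. \<eta> (e, x))"
    unfolding mw_space_def by (rule continuous_map_from_sum_topology)
  then show ?thesis
    using e outside by (auto simp: cfunspace_def topspace_mw_space)
qed

text \<open>The support is the trace of the clopen sheet
  \<open>{e} \<times> topspace (mw_space G K)\<close>.\<close>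

lemma edge_unit_in_cfunspace:
  assumes e: "e \<in> arcs G"
  shows "edge_unit G K e \<in> cfunspace (mw_edge_space G K)"
  unfolding edge_unit_def
proof (rule cfunspace_indicator)
  have eq: "{e} \<times> mw_piece K (head G e) =
      ({e} \<times> topspace (mw_space G K)) \<inter> {(e, x). e \<in> arcs G \<and> x \<in> mw_piece K (head G e)}"
    using e head_in_verts[OF e] unfolding topspace_mw_space by blast
  show "openin (mw_edge_space G K) ({e} \<times> mw_piece K (head G e))"
    unfolding mw_edge_space_def openin_subtopology
    by (rule exI[of _ "{e} \<times> topspace (mw_space G K)"]) (use e eq in \<open>auto simp: openin_prod_Times_iff\<close>)
  show "closedin (mw_edge_space G K) ({e} \<times> mw_piece K (head G e))"
    unfolding mw_edge_space_def closedin_subtopology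
    by (rule exI[of _ "{e} \<times> topspace (mw_space G K)"]) (use e eq in \<open>auto simp: closedin_prod_Times_iff\<close>)
qed

lemma cfunspace_inner:
  assumes "\<xi> \<in> cfunspace (mw_edge_space G K)" "\<eta> \<in> cfunspace (mw_edge_space G K)"
  shows "(\<lambda>x. \<Sum>e\<in>{e \<in> arcs G. x \<in> mw_piece K (head G e)}. cnj (\<xi> (e, x)) * \<eta> (e, x))
    \<in> cfunspace (mw_space G K)"
proof -
  \<comment> \<open>The index set varies with \<open>x\<close>; as sections vanish off the edge
    space, the sum may run over all arcs, and continuity is then termwise.\<close>
  have "(\<Sum>e\<in>{e \<in> arcs G. x \<in> mw_piece K (head G e)}. cnj (\<xi> (e, x)) * \<eta> (e, x)) =
      (\<Sum>e\<in>arcs G. cnj (\<xi> (e, x)) * \<eta> (e, x))" for x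
    using cfunspace_outside[OF assms(1)]
    by (intro sum.mono_neutral_left) (auto simp: topspace_mw_edge_space)
  moreover have "(\<lambda>x. \<Sum>e\<in>F. cnj (\<xi> (e, x)) * \<eta> (e, x)) \<in> cfunspace (mw_space G K)"
    if "finite F" "F \<subseteq> arcs G" for F
    using that
    by (induction F) (auto simp: cfunspace_zero cfunspace_add cfunspace_mult cfunspace_cnj
        cfunspace_slice assms)
  ultimately show ?thesis by simp
qed

end

section \<open>Isomorphisms of the correspondences\<close>

text \<open>Joins to the isomorphism the homeomorphism that Gelfand duality yields: by
  \<open>\<alpha>_eval\<close>, \<open>\<alpha>\<close> is composition with \<open>g\<close>, the
  inverse of \<open>f\<close>.\<close>

locale mw_isomorphism =
  X: mauldin_williams_graph G K1 \<phi>1 + Y: mauldin_williams_graph G K2 \<phi>2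
  for G :: "('v, 'e) pre_digraph"
    and K1 :: "'v \<Rightarrow> 'a metric" and \<phi>1 :: "'e \<Rightarrow> 'a \<Rightarrow> 'a"
    and K2 :: "'v \<Rightarrow> 'b metric" and \<phi>2 :: "'e \<Rightarrow> 'b \<Rightarrow> 'b" +
  fixes \<alpha> V f g
  assumes iso: "correspondence_isomorphism (mw_correspondence G K1 \<phi>1) (mw_correspondence G K2 \<phi>2) \<alpha> V"
    and homeo: "homeomorphic_maps (mw_space G K1) (mw_space G K2) f g"
    and \<alpha>_eval: "\<And>a x. a \<in> cfunspace (mw_space G K1) \<Longrightarrow> x \<in> topspace (mw_space G K1) \<Longrightarrow>
      \<alpha> a (f x) = a x"
begin

section \<open>Fibrewise form of \<open>V\<close>\<close>

abbreviation "arcs1 x \<equiv> {e \<in> arcs G. x \<in> mw_piece K1 (head G e)}"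
abbreviation "arcs2 y \<equiv> {e \<in> arcs G. y \<in> mw_piece K2 (head G e)}"

text \<open>The matrix of \<open>V\<close> from the fibre over \<open>x\<close> to the fibre over \<open>f x\<close>.\<close>
definition entry where "entry e' e x = V (edge_unit G K1 e) (e', f x)"

lemma V_image: "V ` cfunspace (mw_edge_space G K1) = cfunspace (mw_edge_space G K2)"
  using iso by (auto simp: correspondence_isomorphism_def mw_correspondence_def)

text \<open>Evaluating the algebra-valued identity at \<open>f x\<close> makes \<open>V\<close>
  isometric from the fibre over \<open>x\<close> to the fibre over \<open>f x\<close>.\<close>

lemma V_inner:
  assumes \<xi>: "\<xi> \<in> cfunspace (mw_edge_space G K1)" and \<eta>: "\<eta> \<in> cfunspace (mw_edge_space G K1)"
    and x: "x \<in> topspace (mw_space G K1)"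
  shows "(\<Sum>e\<in>arcs2 (f x). cnj (V \<xi> (e, f x)) * V \<eta> (e, f x)) =
    (\<Sum>e\<in>arcs1 x. cnj (\<xi> (e, x)) * \<eta> (e, x))"
proof -
  let ?inner = "co_inner (mw_correspondence G K1 \<phi>1) \<xi> \<eta>"
  have "?inner \<in> cfunspace (mw_space G K1)"
    using X.cfunspace_inner[OF \<xi> \<eta>] by (simp add: mw_correspondence_def)
  then have "\<alpha> ?inner (f x) = ?inner x" using x by (rule \<alpha>_eval)
  moreover have "co_inner (mw_correspondence G K2 \<phi>2) (V \<xi>) (V \<eta>) = \<alpha> ?inner"
    using iso \<xi> \<eta> by (simp add: correspondence_isomorphism_def mw_correspondence_def)
  ultimately have "co_inner (mw_correspondence G K2 \<phi>2) (V \<xi>) (V \<eta>) (f x) = ?inner x" by simp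
  then show ?thesis by (simp add: mw_correspondence_def)
qed

lemma V_bimodule:
  assumes a: "a \<in> cfunspace (mw_space G K1)" and b: "b \<in> cfunspace (mw_space G K1)"
    and \<xi>: "\<xi> \<in> cfunspace (mw_edge_space G K1)"
  shows "V (\<lambda>(e, x). a (mw_map G \<phi>1 e x) * \<xi> (e, x) * b x) (e', y) =
    \<alpha> a (mw_map G \<phi>2 e' y) * V \<xi> (e', y) * \<alpha> b y"
proof -
  have "V (co_right (mw_correspondence G K1 \<phi>1) (co_left (mw_correspondence G K1 \<phi>1) a \<xi>) b) =
    co_right (mw_correspondence G K2 \<phi>2) (co_left (mw_correspondence G K2 \<phi>2) (\<alpha> a) (V \<xi>)) (\<alpha> b)"
    using iso a b \<xi>
    by (simp add: correspondence_isomorphism_def mw_correspondence_def cfun_algebra_def)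
  then show ?thesis by (simp add: mw_correspondence_def case_prod_unfold)
qed

text \<open>
  The functions \<open>a \<circ> \<phi>1 e\<close> and \<open>a\<close> act in the same way on \<open>edge_unit G K1 e\<close>, from the right and
  from the left, and both actions commute with \<open>V\<close>.
\<close>
lemma entry_nonzero_imp:
  assumes e: "e \<in> arcs G" "e' \<in> arcs G" and x: "x \<in> mw_piece K1 (head G e)"
    and fx: "f x \<in> mw_piece K2 (head G e')" and nz: "entry e' e x \<noteq> 0"
  shows "g (mw_map G \<phi>2 e' (f x)) = mw_map G \<phi>1 e x"
proof (rule cfunspace_separates[OF X.compact_space_mw_space X.Hausdorff_space_mw_space])
  let ?y = "mw_map G \<phi>2 e' (f x)"
  have y: "?y \<in> topspace (mw_space G K2)"
    using Y.mw_map_in_topspace[OF e(2) fx] .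
  show gy: "g ?y \<in> topspace (mw_space G K1)"
    using y homeo by (auto simp: homeomorphic_maps_def continuous_map_def)
  have fgy: "f (g ?y) = ?y" using y homeo by (auto simp: homeomorphic_maps_def)
  show "mw_map G \<phi>1 e x \<in> topspace (mw_space G K1)"
    using X.mw_map_in_topspace[OF e(1) x] .
  have xK: "x \<in> topspace (mw_space G K1)"
    using x X.head_in_verts[OF e(1)] unfolding topspace_mw_space by blast
  fix a assume a: "a \<in> cfunspace (mw_space G K1)"
  \<comment> \<open>The bimodule law is two-sided; putting the unit \<open>?u\<close> on one side
    isolates the action on the other.\<close>
  let ?u = "indicator (topspace (mw_space G K1)) :: _ \<Rightarrow> complex"
  let ?b = "\<lambda>x. indicator (mw_piece K1 (head G e)) x * a (mw_map G \<phi>1 e x)"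
  let ?\<delta> = "edge_unit G K1 e"
  have b: "?b \<in> cfunspace (mw_space G K1)" by (rule X.cfunspace_pullback[OF e(1) a])
  have act: "(\<lambda>(e, x). a (mw_map G \<phi>1 e x) * ?\<delta> (e, x) * ?u x) =
      (\<lambda>(e, x). ?u (mw_map G \<phi>1 e x) * ?\<delta> (e, x) * ?b x)"
  proof (intro ext, clarify)
    fix d z
    show "a (mw_map G \<phi>1 d z) * ?\<delta> (d, z) * ?u z = ?u (mw_map G \<phi>1 d z) * ?\<delta> (d, z) * ?b z"
    proof (cases "d = e \<and> z \<in> mw_piece K1 (head G e)")
      case True
      then have "z \<in> topspace (mw_space G K1)"
        using X.head_in_verts[OF e(1)] unfolding topspace_mw_space by blast
      then show ?thesis using True X.mw_map_in_topspace[OF e(1)] by simp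
    qed (auto simp: edge_unit_def)
  qed
  note left = V_bimodule[OF a cfunspace_unit X.edge_unit_in_cfunspace[OF e(1)], of e' "f x"]
  note right = V_bimodule[OF cfunspace_unit b X.edge_unit_in_cfunspace[OF e(1)], of e' "f x"]
  have "\<alpha> a ?y * entry e' e x * \<alpha> ?u (f x) = \<alpha> ?u ?y * entry e' e x * \<alpha> ?b (f x)"
    unfolding entry_def by (rule trans[OF sym[OF left[unfolded act]] right])
  moreover have "\<alpha> ?u (f x) = 1" "\<alpha> ?b (f x) = a (mw_map G \<phi>1 e x)"
    using \<alpha>_eval[OF cfunspace_unit xK] \<alpha>_eval[OF b xK] x xK by auto
  \<comment> \<open>\<open>?y\<close> equals \<open>f (g ?y)\<close>, so
    \<open>\<alpha>_eval\<close> also computes values at \<open>?y\<close>.\<close>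
  moreover have "\<alpha> ?u ?y = 1" "\<alpha> a ?y = a (g ?y)"
    using \<alpha>_eval[OF cfunspace_unit gy] \<alpha>_eval[OF a gy] gy fgy by auto
  ultimately show "a (g ?y) = a (mw_map G \<phi>1 e x)" using nz by simp
qed

text \<open>The basis sections are orthonormal in the fibre over \<open>x\<close>, and
  \<open>V\<close> preserves the pairing.\<close>

lemma entry_orthonormal_cols:
  assumes x: "x \<in> topspace (mw_space G K1)" and e: "e \<in> arcs1 x" "e'' \<in> arcs1 x"
  shows "(\<Sum>e'\<in>arcs2 (f x). cnj (entry e' e x) * entry e' e'' x) = (if e = e'' then 1 else 0)"
proof -
  have "(\<Sum>e'\<in>arcs2 (f x). cnj (entry e' e x) * entry e' e'' x) =
      (\<Sum>d\<in>arcs1 x. cnj (edge_unit G K1 e (d, x)) * edge_unit G K1 e'' (d, x))"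
    unfolding entry_def using e x by (intro V_inner X.edge_unit_in_cfunspace) auto
  also have "\<dots> = (\<Sum>d\<in>arcs1 x. if d = e then if e = e'' then 1 else 0 else 0)"
    by (intro sum.cong) (auto simp: edge_unit_def indicator_def)
  also have "\<dots> = (if e = e'' then 1 else 0)" using e X.finite_arcs by simp
  finally show ?thesis .
qed

text \<open>Surjectivity of \<open>V\<close> enters here: the basis sections over \<open>K2\<close>
  have preimages, whose coordinates at \<open>x\<close> are the conjugated entries, so
  orthonormality is carried back.\<close>

lemma entry_orthonormal_rows:
  assumes x: "x \<in> topspace (mw_space G K1)" and e: "e \<in> arcs2 (f x)" "e' \<in> arcs2 (f x)"
  shows "(\<Sum>d\<in>arcs1 x. entry e d x * cnj (entry e' d x)) = (if e = e' then 1 else 0)"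
proof -
  have "\<exists>\<xi>\<in>cfunspace (mw_edge_space G K1). V \<xi> = edge_unit G K2 c" if "c \<in> arcs G" for c
    using Y.edge_unit_in_cfunspace[OF that] unfolding V_image[symmetric] by (metis imageE)
  then obtain \<xi> where \<xi>: "\<And>c. c \<in> arcs G \<Longrightarrow> \<xi> c \<in> cfunspace (mw_edge_space G K1)"
    "\<And>c. c \<in> arcs G \<Longrightarrow> V (\<xi> c) = edge_unit G K2 c"
    by metis
  \<comment> \<open>Pairing with the basis section of \<open>d\<close> reads off the coordinate, and
    \<open>V_inner\<close> moves this pairing to the fibre over \<open>f x\<close>.\<close>
  have \<xi>_eq: "\<xi> c (d, x) = cnj (entry c d x)" if c: "c \<in> arcs2 (f x)" and d: "d \<in> arcs1 x" for c d
  proof -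
    have "\<xi> c (d, x) = (\<Sum>d'\<in>arcs1 x. if d' = d then \<xi> c (d', x) else 0)"
      using d X.finite_arcs by simp
    also have "\<dots> = (\<Sum>d'\<in>arcs1 x. cnj (edge_unit G K1 d (d', x)) * \<xi> c (d', x))"
      using d by (intro sum.cong) (auto simp: edge_unit_def indicator_def)
    also have "\<dots> = (\<Sum>c'\<in>arcs2 (f x). cnj (entry c' d x) * V (\<xi> c) (c', f x))"
      unfolding entry_def using c d x by (intro V_inner[symmetric] X.edge_unit_in_cfunspace \<xi>) auto
    also have "\<dots> = (\<Sum>c'\<in>arcs2 (f x). if c' = c then cnj (entry c d x) else 0)"
      using c by (intro sum.cong) (auto simp: edge_unit_def indicator_def \<xi>)
    also have "\<dots> = cnj (entry c d x)" using c X.finite_arcs by simp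
    finally show ?thesis .
  qed
  have "(\<Sum>d\<in>arcs1 x. entry e d x * cnj (entry e' d x)) =
      (\<Sum>d\<in>arcs1 x. cnj (\<xi> e (d, x)) * \<xi> e' (d, x))"
    using e by (intro sum.cong refl) (simp add: \<xi>_eq)
  also have "\<dots> = (\<Sum>c\<in>arcs2 (f x). cnj (V (\<xi> e) (c, f x)) * V (\<xi> e') (c, f x))"
    using e x by (intro V_inner[symmetric] \<xi>) auto
  also have "\<dots> = (\<Sum>c\<in>arcs2 (f x). if c = e then if e = e' then 1 else 0 else 0)"
    using e by (intro sum.cong) (auto simp: edge_unit_def indicator_def \<xi>)
  also have "\<dots> = (if e = e' then 1 else 0)" using e X.finite_arcs by simp
  finally show ?thesis .
qed

text \<open>The second alternative covers points where both partial maps are undefined. The first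
  asks for a nonzero entry instead of the equation of the maps, since this is an open condition and
  implies the equation.\<close>

definition good_at where
  "good_at p e = {x \<in> topspace (mw_space G K1).
    f x \<in> mw_piece K2 (head G e) \<and> x \<in> mw_piece K1 (head G (p e)) \<and> entry e (p e) x \<noteq> 0 \<or>
    f x \<notin> mw_piece K2 (head G e) \<and> x \<notin> mw_piece K1 (head G (p e))}"

definition good_set where
  "good_set p = (\<Inter>e\<in>arcs G. good_at p e) \<inter> topspace (mw_space G K1)"

lemma good_set_covers:
  assumes x: "x \<in> topspace (mw_space G K1)"
  shows "\<exists>p. p permutes arcs G \<and> x \<in> good_set p"
proof -
  obtain \<sigma> where \<sigma>: "bij_betw \<sigma> (arcs2 (f x)) (arcs1 x)" "\<forall>e\<in>arcs2 (f x). entry e (\<sigma> e) x \<noteq> 0"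
    using unitary_matrix_transversal[of "arcs2 (f x)" "arcs1 x" "\<lambda>e e'. entry e e' x"]
      entry_orthonormal_rows[OF x] entry_orthonormal_cols[OF x] X.finite_arcs by auto
  obtain p where p: "p permutes arcs G" "\<And>e. e \<in> arcs2 (f x) \<Longrightarrow> p e = \<sigma> e"
    by (rule bij_betw_extend_permutes[OF X.finite_arcs _ _ \<sigma>(1)]) auto
  \<comment> \<open>As \<open>p\<close> is injective and maps \<open>arcs2 (f x)\<close> onto
    \<open>arcs1 x\<close>, it sends no other edge into \<open>arcs1 x\<close>; so the two maps are
    defined at the same points.\<close>
  have "p ` arcs2 (f x) = \<sigma> ` arcs2 (f x)" by (rule image_cong[OF refl p(2)])
  also have "\<dots> = arcs1 x" by (rule bij_betw_imp_surj_on[OF \<sigma>(1)])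
  finally have "p e \<in> arcs1 x \<longleftrightarrow> e \<in> arcs2 (f x)" for e
    using inj_image_mem_iff[OF permutes_inj[OF p(1)], of e "arcs2 (f x)"] by simp
  then have "f x \<in> mw_piece K2 (head G e) \<longleftrightarrow> x \<in> mw_piece K1 (head G (p e))" if "e \<in> arcs G" for e
    using that permutes_in_image[OF p(1)] by blast
  moreover have "entry e (p e) x \<noteq> 0" if "e \<in> arcs G" "f x \<in> mw_piece K2 (head G e)" for e
    using that \<sigma>(2) p(2) by auto
  ultimately show ?thesis using x p(1) by (auto simp: good_set_def good_at_def good_at_def)
qed

text \<open>The pieces and their preimages under \<open>f\<close> are clopen and nonvanishing of a
  continuous entry is open, so both alternatives of \<open>good_at\<close> are open.\<close>

lemma openin_good_set:
  assumes p: "p permutes arcs G"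
  shows "openin (mw_space G K1) (good_set p)"
proof -
  let ?X = "mw_space G K1"
  have cont_f: "continuous_map ?X (mw_space G K2) f" using homeo by (simp add: homeomorphic_maps_def)
  have "openin ?X (good_at p e)" if e: "e \<in> arcs G" for e
  proof -
    have pe: "p e \<in> arcs G" using e p by (simp add: permutes_in_image)
    define P where "P = {x \<in> topspace ?X. f x \<in> mw_piece K2 (head G e)}"
    define Q where "Q = mw_piece K1 (head G (p e))"
    have P: "openin ?X P" "closedin ?X P"
      unfolding P_def using e cont_f
      by (auto intro!: openin_continuous_map_preimage closedin_continuous_map_preimage
          openin_mw_piece closedin_mw_piece)
    have Q: "openin ?X Q" "closedin ?X Q"
      unfolding Q_def using pe by (auto intro!: openin_mw_piece closedin_mw_piece)
    \<comment> \<open>As a function of \<open>x\<close>, the entry is a slice of a section over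
      \<open>K2\<close> composed with \<open>f\<close>.\<close>
    have "continuous_map ?X euclidean (entry e (p e))"
      using continuous_map_compose[OF cont_f cfunspace_continuous[OF Y.cfunspace_slice[OF e]]]
        imageI[OF X.edge_unit_in_cfunspace[OF pe], of V] V_image
      by (simp add: entry_def[abs_def] o_def)
    then have R: "openin ?X {x \<in> topspace ?X. entry e (p e) x \<in> - {0}}"
      by (rule openin_continuous_map_preimage) auto
    have "good_at p e = (P \<inter> Q \<inter> {x \<in> topspace ?X. entry e (p e) x \<in> - {0}}) \<union>
        ((topspace ?X - P) \<inter> (topspace ?X - Q))"
      by (auto simp: good_at_def P_def Q_def)
    also have "openin ?X \<dots>"
      using P Q R by (intro openin_Un openin_Int openin_diff openin_topspace)
    finally show ?thesis .
  qed
  then show ?thesis unfolding good_set_def by (intro openin_INT X.finite_arcs)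
qed

end

theorem theorem3p3:
  fixes G :: "('v, 'e) pre_digraph"
    and K1 :: "'v \<Rightarrow> 'a metric" and \<phi>1 :: "'e \<Rightarrow> 'a \<Rightarrow> 'a"
    and K2 :: "'v \<Rightarrow> 'b metric" and \<phi>2 :: "'e \<Rightarrow> 'b \<Rightarrow> 'b"
  assumes "mauldin_williams_graph G K1 \<phi>1" and "invariant_list G K1 \<phi>1"
    and "mauldin_williams_graph G K2 \<phi>2" and "invariant_list G K2 \<phi>2"
    and "isomorphic_correspondences (mw_correspondence G K1 \<phi>1) (mw_correspondence G K2 \<phi>2)"
  shows "\<exists>f f_inv. homeomorphic_maps (mw_space G K1) (mw_space G K2) f f_inv \<and>
    (\<exists>(m::nat) (U :: nat \<Rightarrow> ('v \<times> 'a) set) (\<sigma> :: nat \<Rightarrow> 'e \<Rightarrow> 'e).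
      (\<forall>j\<in>{1..m}. openin (mw_space G K1) (U j)) \<and>
      (\<Union>j\<in>{1..m}. U j) = topspace (mw_space G K1) \<and>
      (\<forall>j\<in>{1..m}. \<sigma> j permutes arcs G) \<and>
      (\<forall>j\<in>{1..m}. \<forall>e\<in>arcs G. \<forall>x\<in>U j.
        (f x \<in> mw_piece K2 (head G e) \<longleftrightarrow> x \<in> mw_piece K1 (head G (\<sigma> j e))) \<and>
        (f x \<in> mw_piece K2 (head G e) \<longrightarrow>
          f_inv (mw_map G \<phi>2 e (f x)) = mw_map G \<phi>1 (\<sigma> j e) x)))"
proof -
  interpret X: mauldin_williams_graph G K1 \<phi>1 by fact
  interpret Y: mauldin_williams_graph G K2 \<phi>2 by fact
  obtain \<alpha> V where
    iso: "correspondence_isomorphism (mw_correspondence G K1 \<phi>1) (mw_correspondence G K2 \<phi>2) \<alpha> V"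
    using assms(5) unfolding isomorphic_correspondences_def by blast
  then have "star_isomorphism (cfun_algebra (mw_space G K1)) (cfun_algebra (mw_space G K2)) \<alpha>"
    by (simp add: correspondence_isomorphism_def mw_correspondence_def)
  then obtain f g where fg: "homeomorphic_maps (mw_space G K1) (mw_space G K2) f g"
    "\<And>a x. a \<in> cfunspace (mw_space G K1) \<Longrightarrow> x \<in> topspace (mw_space G K1) \<Longrightarrow> \<alpha> a (f x) = a x"
    by (rule star_isomorphism_cfun_homeomorphism[OF X.compact_space_mw_space
          X.Hausdorff_space_mw_space Y.compact_space_mw_space Y.Hausdorff_space_mw_space]) blast
  interpret mw_isomorphism G K1 \<phi>1 K2 \<phi>2 \<alpha> V f g
    by unfold_locales (use iso fg in auto)
  \<comment> \<open>All permutations of the edges index the cover; \<open>good_set\<close> may be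
    empty for some of them.\<close>
  let ?M = "{p. p permutes arcs G}"
  obtain m :: nat and \<sigma> where \<sigma>: "bij_betw \<sigma> {1..m} ?M"
    using ex_bij_betw_nat_finite_1[OF finite_permutations[OF X.finite_arcs]] by blast
  then have image: "\<sigma> ` {1..m} = ?M" by (simp add: bij_betw_def)
  then have perm: "\<sigma> j permutes arcs G" if "j \<in> {1..m}" for j using that by blast
  have "(\<Union>j\<in>{1..m}. good_set (\<sigma> j)) = (\<Union>p\<in>?M. good_set p)"
    unfolding image[symmetric] by (simp add: image_image)
  also have "\<dots> = topspace (mw_space G K1)"
    using good_set_covers by (auto simp: good_set_def good_at_def)
  finally have cover: "(\<Union>j\<in>{1..m}. good_set (\<sigma> j)) = topspace (mw_space G K1)" .
  \<comment> \<open>The equivalence is read off from the two alternatives in \<open>good_at\<close>;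
    the equation comes from the nonzero entry.\<close>
  have conj: "(f x \<in> mw_piece K2 (head G e) \<longleftrightarrow> x \<in> mw_piece K1 (head G (\<sigma> j e))) \<and>
      (f x \<in> mw_piece K2 (head G e) \<longrightarrow> g (mw_map G \<phi>2 e (f x)) = mw_map G \<phi>1 (\<sigma> j e) x)"
    if j: "j \<in> {1..m}" and e: "e \<in> arcs G" and x: "x \<in> good_set (\<sigma> j)" for j e x
    using x e permutes_in_image[OF perm[OF j]] unfolding good_set_def good_at_def
    by (auto intro!: entry_nonzero_imp)
  show ?thesis
    by (rule exI[of _ f], rule exI[of _ g], rule conjI[OF fg(1)], rule exI[of _ m],
        rule exI[of _ "\<lambda>j. good_set (\<sigma> j)"], rule exI[of _ \<sigma>])
      (use perm cover openin_good_set conj in blast)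
qed

end
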